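(* Let $\alpha\in(0,1)$, let $\tau,h>0$ be arbitrary, and let $f=f^++f^-$ with $f^\pm:\mathbb{R}\to\mathbb{R}$ continuously differentiable, $(f^+)'\ge 0$ and $(f^-)'\le 0$. Let $(U_j^n)_{j\in\mathbb{Z},n\ge 0}$ be a real solution of the implicit upwind scheme, i.e. for all $j\in\mathbb{Z}$, $n\ge 0$, $$D_t^\alpha U_j^{n+1}+\frac1h\big(f^+(U_j^{n+1})-f^+(U_{j-1}^{n+1})\big)+\frac1h\big(f^-(U_{j+1}^{n+1})-f^-(U_j^{n+1})\big)=0,$$ such that $\mathrm{TV}[U^n]:=\sum_{j\in\mathbb{Z}}|U_{j+1}^n-U_j^n|<\infty$ for every $n\ge 0$. Then the scheme is unconditionally TVD: for all $n\ge 1$ (with no restriction relating $\tau$ and $h$), $\mathrm{TV}[U^n]\le\mathrm{TV}[U^0]$.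
   Context: The scheme approximates the conservation law $\partial_t^\alpha u+(f(u))_x=0$ with Caputo derivative $\partial_t^\alpha$, on a uniform grid with time step $\tau$ and mesh size $h$. The discrete Caputo derivative is $$D_t^\alpha U_j^{n+1}=\frac{1}{\Gamma(2-\alpha)\tau^\alpha}\Big(U_j^{n+1}-\sum_{k=0}^n c_k^{n+1}U_j^k\Big),\qquad n\ge 0,$$ with $c_0^{n+1}=(n+1)^{1-\alpha}-n^{1-\alpha}$ and $c_k^{n+1}=2(n+1-k)^{1-\alpha}-(n+2-k)^{1-\alpha}-(n-k)^{1-\alpha}$ for $1\le k\le n$ (with $0^{1-\alpha}=0$). *)

theory Defs
  imports "HOL-Analysis.Analysis"
begin

text \<open>
  \<open>caputo_weight \<alpha> n k\<close> is the weight $c_k^{n+1}$, used for \<open>k \<le> n\<close>.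
  The convention $0^{1-\alpha} = 0$ is that of \<open>powr\<close>.
\<close>

definition caputo_weight :: "real \<Rightarrow> nat \<Rightarrow> nat \<Rightarrow> real" where
  "caputo_weight \<alpha> n k =
    (if k = 0
     then (real n + 1) powr (1 - \<alpha>) - real n powr (1 - \<alpha>)
     else 2 * (real n + 1 - real k) powr (1 - \<alpha>)
          - (real n + 2 - real k) powr (1 - \<alpha>)
          - (real n - real k) powr (1 - \<alpha>))"

text \<open>
  \<open>discrete_caputo \<alpha> \<tau> u n\<close> is the discrete Caputo derivative of the time sequence \<open>u\<close>
  at the time level \<open>n + 1\<close>.
\<close>

definition discrete_caputo :: "real \<Rightarrow> real \<Rightarrow> (nat \<Rightarrow> real) \<Rightarrow> nat \<Rightarrow> real" where
  "discrete_caputo \<alpha> \<tau> u n =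
    1 / (Gamma (2 - \<alpha>) * \<tau> powr \<alpha>) *
      (u (n + 1) - (\<Sum>k = 0..n. caputo_weight \<alpha> n k * u k))"

text \<open>Grid functions are written \<open>U n j\<close> for $U_j^n$: time level first, then space index.\<close>

definition implicit_upwind_solution ::
  "real \<Rightarrow> real \<Rightarrow> real \<Rightarrow> (real \<Rightarrow> real) \<Rightarrow> (real \<Rightarrow> real) \<Rightarrow> (nat \<Rightarrow> int \<Rightarrow> real) \<Rightarrow> bool" where
  "implicit_upwind_solution \<alpha> \<tau> h fp fm U \<longleftrightarrow>
    (\<forall>j n. discrete_caputo \<alpha> \<tau> (\<lambda>m. U m j) n
           + 1 / h * (fp (U (n + 1) j) - fp (U (n + 1) (j - 1)))
           + 1 / h * (fm (U (n + 1) (j + 1)) - fm (U (n + 1) j)) = 0)"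

definition finite_TV :: "(int \<Rightarrow> real) \<Rightarrow> bool" where
  "finite_TV v \<longleftrightarrow> (\<lambda>j. \<bar>v (j + 1) - v j\<bar>) summable_on UNIV"

text \<open>\<open>infsum\<close> returns 0 on a divergent sum, so \<open>TV v\<close> is meaningful only if \<open>finite_TV v\<close>.\<close>

definition TV :: "(int \<Rightarrow> real) \<Rightarrow> real" where
  "TV v = (\<Sum>\<^sub>\<infinity>j. \<bar>v (j + 1) - v j\<bar>)"

end

theory Submission
  imports Defs
begin

text \<open>
  The spatial part of one time step is an implicit monotone upwind scheme. Multiplying the
  equation for the increments by their sign gives a telescoping inequality, so the step does
  not increase total variation, whatever the step sizes. It is applied to the history
  $\sum_k c_k^{n+1} U^k$, whose total variation is at most that of $U^0$ by induction, because
  the weights are a convex combination: nonnegative by concavity of $x^{1-\alpha}$ and of sum one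
  by telescoping.
\<close>

section \<open>Convexity of the Caputo weights\<close>

text \<open>Dividing by \<open>m powr \<beta>\<close> moves the centre to 1, and the tangent line at
  1 lies above the power: its values at \<open>(m + 1) / m\<close> and \<open>(m - 1) / m\<close>
  add up to 2.\<close>

lemma powr_second_difference_nonpos:
  fixes \<beta> m :: real
  assumes "0 < \<beta>" "\<beta> < 1" "1 \<le> m"
  shows "(m + 1) powr \<beta> + (m - 1) powr \<beta> \<le> 2 * m powr \<beta>"
proof -
  \<comment> \<open>Weighted arithmetic-geometric mean inequality for \<open>t\<close> and 1. The
    case \<open>t = 0\<close> occurs for \<open>m = 1\<close>, that is, for the weight with
    \<open>k = n\<close>.\<close>
  have bernoulli: "t powr \<beta> \<le> \<beta> * t + (1 - \<beta>)" if "0 \<le> t" for t :: real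
    using Youngs_inequality_0[of \<beta> "1 - \<beta>" t 1] that assms by (cases "t = 0") auto
  have scale: "m powr \<beta> * (s / m) powr \<beta> = s powr \<beta>" if "0 \<le> s" for s
    using that assms by (simp add: powr_divide)
  have "((m + 1) / m) powr \<beta> + ((m - 1) / m) powr \<beta>
      \<le> (\<beta> * ((m + 1) / m) + (1 - \<beta>)) + (\<beta> * ((m - 1) / m) + (1 - \<beta>))"
    using assms by (intro add_mono bernoulli) auto
  also have "\<dots> = 2"
    using assms by (simp add: field_simps)
  finally have "m powr \<beta> * (((m + 1) / m) powr \<beta> + ((m - 1) / m) powr \<beta>) \<le> m powr \<beta> * 2"
    by (intro mult_left_mono) auto
  then show ?thesis
    using assms by (simp add: distrib_left scale mult.commute)
qed

lemma caputo_weight_nonneg: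
  assumes "0 < \<alpha>" "\<alpha> < 1" "k \<le> n"
  shows "0 \<le> caputo_weight \<alpha> n k"
proof (cases "k = 0")
  case True
  then show ?thesis
    using assms by (simp add: caputo_weight_def powr_mono2)
next
  case False
  then show ?thesis
    using powr_second_difference_nonpos[of "1 - \<alpha>" "real n + 1 - real k"] assms
    by (simp add: caputo_weight_def algebra_simps)
qed

lemma sum_caputo_weight: "(\<Sum>k = 0..n. caputo_weight \<alpha> n k) = 1"
proof -
  \<comment> \<open>For \<open>k \<ge> 1\<close> the weight is \<open>w (Suc k) - w k\<close>. The
    lower end \<open>w (Suc 0)\<close> cancels the weight for \<open>k = 0\<close>, and
    \<open>w (Suc n) = 1\<close> because 0 to any power is 0 under \<open>powr\<close>.\<close>
  define w where "w k = (real n + 2 - real k) powr (1 - \<alpha>) - (real n + 1 - real k) powr (1 - \<alpha>)"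
    for k
  have "(\<Sum>k = 0..n. caputo_weight \<alpha> n k)
      = caputo_weight \<alpha> n 0 + (\<Sum>k = Suc 0..n. caputo_weight \<alpha> n k)"
    by (simp add: sum.atLeast_Suc_atMost)
  also have "(\<Sum>k = Suc 0..n. caputo_weight \<alpha> n k) = (\<Sum>k = Suc 0..n. w (Suc k) - w k)"
    by (intro sum.cong refl) (simp add: caputo_weight_def w_def algebra_simps)
  also have "\<dots> = w (Suc n) - w (Suc 0)"
    by (intro sum_Suc_diff) simp
  also have "caputo_weight \<alpha> n 0 + \<dots> = 1"
    by (simp add: caputo_weight_def w_def algebra_simps)
  finally show ?thesis .
qed

section \<open>Behaviour at infinity of grid functions of finite variation\<close>

text \<open>Transfers limits at the right end of the grid to the left end. Reflection sends the edge
  from \<open>j\<close> to \<open>j + 1\<close> to the edge starting at \<open>- j - 1\<close>,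
  hence the shift in the bijection.\<close>

lemma finite_TV_reflect:
  assumes "finite_TV v"
  shows "finite_TV (\<lambda>j. v (- j))"
proof -
  have "bij (\<lambda>j::int. - j - 1)"
    by (rule bijI') (auto intro: exI[of _ "- x - 1" for x])
  from summable_on_reindex_bij_betw[OF this, of "\<lambda>j. \<bar>v (j + 1) - v j\<bar>"]
  show ?thesis
    using assms by (simp add: finite_TV_def abs_minus_commute algebra_simps)
qed

lemma finite_TV_convergent:
  assumes "finite_TV v"
  shows "convergent (\<lambda>n. v (int n))"
proof -
  have "(\<lambda>j. \<bar>v (j + 1) - v j\<bar>) summable_on range int"
    using assms unfolding finite_TV_def by (rule summable_on_subset_banach) auto
  then have "(\<lambda>n. \<bar>v (int n + 1) - v (int n)\<bar>) summable_on UNIV"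
    by (subst (asm) summable_on_reindex) (auto simp: o_def)
  then have "summable (\<lambda>n. \<bar>v (int (Suc n)) - v (int n)\<bar>)"
    by (auto dest!: summable_on_imp_summable simp: add.commute)
  then have "summable (\<lambda>n. v (int (Suc n)) - v (int n))"
    by (rule summable_rabs_cancel)
  then have "convergent (\<lambda>N. \<Sum>n<N. v (int (Suc n)) - v (int n))"
    by (simp add: summable_iff_convergent)
  then have "convergent (\<lambda>N. v (int N) - v 0)"
    by (subst (asm) sum_lessThan_telescope) simp
  from convergent_add[OF this convergent_const[of "v 0"]] show ?thesis
    by simp
qed

text \<open>A continuous \<open>g\<close> need not be uniformly continuous, so small increments of
  \<open>v\<close> alone would not suffice; the limit of \<open>v\<close> reduces the claim to
  continuity at one point.\<close>

lemma finite_TV_increments_tendsto_0: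
  fixes g :: "real \<Rightarrow> real"
  assumes "finite_TV v" "continuous_on UNIV g"
  shows "(\<lambda>n. g (v (int n + 1)) - g (v (int n))) \<longlonglongrightarrow> 0"
proof -
  obtain l where "(\<lambda>n. v (int n)) \<longlonglongrightarrow> l"
    using finite_TV_convergent[OF assms(1)] by (auto simp: convergent_def)
  then have lim: "(\<lambda>n. g (v (int n))) \<longlonglongrightarrow> g l"
    using assms(2) continuous_on_tendsto_compose by fastforce
  from tendsto_diff[OF LIMSEQ_Suc[OF this] this] show ?thesis
    by (simp add: add.commute)
qed

lemma sum_int_symmetric_telescope:
  fixes a :: "int \<Rightarrow> 'a::ab_group_add"
  shows "(\<Sum>j = - int N..int N. a (j + 1) - a j) = a (int N + 1) - a (- int N)"
proof (induction N)
  case (Suc N)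
  have "{- int (Suc N)..int (Suc N)} = insert (- 1 - int N) (insert (int N + 1) {- int N..int N})"
    by auto
  with Suc show ?case
    by (simp add: algebra_simps)
qed simp

text \<open>Every finite set of integers lies in some symmetric window, so window sums converge to
  the infinite sum; \<open>r\<close> is for boundary terms left by telescoping.\<close>

lemma infsum_le_symmetric_limit:
  fixes a :: "int \<Rightarrow> real"
  assumes "a summable_on UNIV" "\<And>N. (\<Sum>j = - int N..int N. a j) \<le> b + r N" "r \<longlonglongrightarrow> 0"
  shows "infsum a UNIV \<le> b"
proof -
  have "filterlim (\<lambda>N. {- int N..int N}) (finite_subsets_at_top UNIV) sequentially"
    unfolding filterlim_finite_subsets_at_top
  proof safe
    fix X :: "int set"
    assume "finite X"
    then obtain B where B: "\<And>x. x \<in> X \<Longrightarrow> \<bar>x\<bar> \<le> B"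
      using bdd_above.unfold[of "abs ` X"] by (metis bdd_above_finite finite_imageI image_eqI)
    show "\<forall>\<^sub>F N in sequentially. finite {- int N..int N} \<and> X \<subseteq> {- int N..int N} \<and> {- int N..int N} \<subseteq> UNIV"
      using eventually_ge_at_top[of "nat B"] by eventually_elim (use B in fastforce)
  qed
  with has_sum_infsum[OF assms(1)]
  have "(\<lambda>N. \<Sum>j = - int N..int N. a j) \<longlonglongrightarrow> infsum a UNIV"
    unfolding has_sum_def by (rule filterlim_compose)
  moreover have "(\<lambda>N. b + r N) \<longlonglongrightarrow> b"
    using tendsto_add[OF tendsto_const assms(3), of b] by simp
  ultimately show ?thesis
    using assms(2) by (intro LIMSEQ_le) auto
qed

section \<open>One implicit monotone step\<close>

lemma monotone_implicit_step_TV_le: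
  fixes p q :: "real \<Rightarrow> real"
  assumes p: "mono p" "continuous_on UNIV p"
    and q: "antimono q" "continuous_on UNIV q"
    and step: "\<And>j. v j - w j + (p (v j) - p (v (j - 1))) + (q (v (j + 1)) - q (v j)) = 0"
    and fin: "finite_TV v" "finite_TV w"
  shows "TV v \<le> TV w"
proof -
  define P where "P j = \<bar>p (v (j + 1)) - p (v j)\<bar>" for j
  define Q where "Q j = \<bar>q (v (j + 1)) - q (v j)\<bar>" for j
  \<comment> \<open>Difference of the equations at \<open>j + 1\<close> and \<open>j\<close>, times
    the sign of \<open>v (j + 1) - v j\<close>. By monotonicity the flux increments on this edge
    become exactly \<open>P j\<close> and \<open>Q j\<close>; those on the neighbouring edges have
    unknown sign and are bounded by \<open>P (j - 1)\<close> and \<open>Q (j + 1)\<close>.\<close>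
  have local: "\<bar>v (j + 1) - v j\<bar> + (P j - P (j - 1)) - (Q (j + 1) - Q j) \<le> \<bar>w (j + 1) - w j\<bar>" for j
  proof -
    have s: "v (j + 1) - w (j + 1) + (p (v (j + 1)) - p (v j)) + (q (v (j + 1 + 1)) - q (v (j + 1))) = 0"
      using step[of "j + 1"] by simp
    have bounds: "p (v j) - p (v (j - 1)) \<le> P (j - 1)" "p (v (j - 1)) - p (v j) \<le> P (j - 1)"
      "q (v (j + 1 + 1)) - q (v (j + 1)) \<le> Q (j + 1)" "q (v (j + 1)) - q (v (j + 1 + 1)) \<le> Q (j + 1)"
      by (simp_all add: P_def Q_def)
    show ?thesis
    proof (cases "v j \<le> v (j + 1)")
      case True
      then have "p (v j) \<le> p (v (j + 1))" "q (v (j + 1)) \<le> q (v j)"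
        by (simp_all add: monoD[OF p(1)] antimonoD[OF q(1)])
      with True have "\<bar>v (j + 1) - v j\<bar> + (P j - P (j - 1)) - (Q (j + 1) - Q j)
          = v (j + 1) - v j + (p (v (j + 1)) - p (v j) - P (j - 1)) - (Q (j + 1) - (q (v j) - q (v (j + 1))))"
        by (simp add: P_def[of j] Q_def[of j])
      also have "\<dots> \<le> w (j + 1) - w j"
        using s step[of j] bounds by linarith
      finally show ?thesis
        by (rule order_trans) (rule abs_ge_self)
    next
      case False
      then have "p (v (j + 1)) \<le> p (v j)" "q (v j) \<le> q (v (j + 1))"
        by (simp_all add: monoD[OF p(1)] antimonoD[OF q(1)])
      with False have "\<bar>v (j + 1) - v j\<bar> + (P j - P (j - 1)) - (Q (j + 1) - Q j)
          = v j - v (j + 1) + (p (v j) - p (v (j + 1)) - P (j - 1)) - (Q (j + 1) - (q (v (j + 1)) - q (v j)))"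
        by (simp add: P_def[of j] Q_def[of j])
      also have "\<dots> \<le> - (w (j + 1) - w j)"
        using s step[of j] bounds by linarith
      finally show ?thesis
        by (rule order_trans) (rule abs_ge_minus_self)
    qed
  qed
  define r where "r N = P (- int N - 1) + Q (int N + 1)" for N
  have "(\<Sum>j = - int N..int N. \<bar>v (j + 1) - v j\<bar>) \<le> TV w + r N" for N
  proof -
    let ?I = "{- int N..int N}"
    have "(\<Sum>j\<in>?I. \<bar>v (j + 1) - v j\<bar>) + (\<Sum>j\<in>?I. P j - P (j - 1)) - (\<Sum>j\<in>?I. Q (j + 1) - Q j)
        \<le> (\<Sum>j\<in>?I. \<bar>w (j + 1) - w j\<bar>)"
      using sum_mono[where K = ?I, OF local] by (simp only: sum.distrib sum_subtractf)
    moreover have "(\<Sum>j\<in>?I. P j - P (j - 1)) = P (int N) - P (- int N - 1)"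
      using sum_int_symmetric_telescope[of "\<lambda>j. P (j - 1)" N] by simp
    moreover have "(\<Sum>j\<in>?I. Q (j + 1) - Q j) = Q (int N + 1) - Q (- int N)"
      by (rule sum_int_symmetric_telescope)
    moreover have "(\<Sum>j\<in>?I. \<bar>w (j + 1) - w j\<bar>) \<le> TV w"
      using fin(2) unfolding TV_def finite_TV_def by (intro finite_sum_le_infsum) auto
    moreover have "P (int N) \<ge> 0" "Q (- int N) \<ge> 0"
      by (auto simp: P_def Q_def)
    ultimately show ?thesis
      by (simp add: r_def)
  qed
  moreover have "r \<longlonglongrightarrow> 0"
  proof -
    have "(\<lambda>N. P (- int N - 1)) \<longlonglongrightarrow> 0"
      using tendsto_rabs_zero[OF finite_TV_increments_tendsto_0[OF finite_TV_reflect[OF fin(1)] p(2)]]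
      by (simp add: P_def abs_minus_commute)
    moreover have "(\<lambda>N. Q (int N + 1)) \<longlonglongrightarrow> 0"
      using LIMSEQ_Suc[OF tendsto_rabs_zero[OF finite_TV_increments_tendsto_0[OF fin(1) q(2)]]]
      by (simp add: Q_def algebra_simps)
    ultimately show ?thesis
      using tendsto_add_zero by (simp add: r_def[abs_def])
  qed
  ultimately show ?thesis
    using fin(1) infsum_le_symmetric_limit unfolding TV_def[of v] finite_TV_def by blast
qed

section \<open>Total variation of the history\<close>

lemma has_sum_sum:
  fixes f :: "'b \<Rightarrow> 'a \<Rightarrow> 'c::topological_comm_monoid_add"
  assumes "finite A" "\<And>k. k \<in> A \<Longrightarrow> (f k has_sum s k) B"
  shows "((\<lambda>x. \<Sum>k\<in>A. f k x) has_sum (\<Sum>k\<in>A. s k)) B"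
  using assms by (induction A rule: finite_induct) (auto intro: has_sum_add)

text \<open>The triangle inequality on each edge gives a summable majorant. Finiteness comes first,
  since \<open>TV\<close> of a divergent sum defaults to 0 and a bound on it would say
  nothing.\<close>

lemma
  assumes "finite A" and c: "\<And>k. k \<in> A \<Longrightarrow> 0 \<le> c k" and fin: "\<And>k. k \<in> A \<Longrightarrow> finite_TV (V k)"
  shows finite_TV_nonneg_combination: "finite_TV (\<lambda>j. \<Sum>k\<in>A. c k * V k j)" (is ?fin)
    and TV_nonneg_combination_le: "TV (\<lambda>j. \<Sum>k\<in>A. c k * V k j) \<le> (\<Sum>k\<in>A. c k * TV (V k))" (is ?le)
proof -
  let ?d = "\<lambda>k j. \<bar>V k (j + 1) - V k j\<bar>"
  let ?s = "\<lambda>j. \<Sum>k\<in>A. c k * V k j"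
  have le: "\<bar>?s (j + 1) - ?s j\<bar> \<le> (\<Sum>k\<in>A. c k * ?d k j)" for j
  proof -
    have "\<bar>?s (j + 1) - ?s j\<bar> = \<bar>\<Sum>k\<in>A. c k * (V k (j + 1) - V k j)\<bar>"
      by (simp add: sum_subtractf right_diff_distrib)
    also have "\<dots> \<le> (\<Sum>k\<in>A. \<bar>c k * (V k (j + 1) - V k j)\<bar>)"
      by (rule sum_abs)
    also have "\<dots> = (\<Sum>k\<in>A. c k * ?d k j)"
      using c by (intro sum.cong refl) (simp add: abs_mult)
    finally show ?thesis .
  qed
  have sums: "((\<lambda>j. \<Sum>k\<in>A. c k * ?d k j) has_sum (\<Sum>k\<in>A. c k * TV (V k))) UNIV"
    using fin unfolding TV_def finite_TV_def
    by (intro has_sum_sum[OF assms(1)] has_sum_cmult_right has_sum_infsum)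
  from summable_on_comparison_test[OF has_sum_imp_summable[OF this] le] show ?fin
    by (simp add: finite_TV_def)
  then show ?le
    using infsum_mono[OF _ has_sum_imp_summable[OF sums] le] infsumI[OF sums]
    by (simp add: TV_def finite_TV_def)
qed

lemma C1_deriv_nonneg_imp_mono:
  fixes g :: "real \<Rightarrow> real"
  assumes "g C1_differentiable_on UNIV" "\<And>x. deriv g x \<ge> 0"
  shows "mono g"
proof (rule monoI)
  fix x y :: real
  assume "x \<le> y"
  have "(g has_real_derivative deriv g t) (at t)" for t
    using assms(1) by (simp add: C1_differentiable_on_eq DERIV_deriv_iff_real_differentiable)
  then show "g x \<le> g y"
    using DERIV_nonneg_imp_nondecreasing[OF \<open>x \<le> y\<close>] assms(2) by blast
qed

lemma C1_deriv_nonpos_imp_antimono: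
  fixes g :: "real \<Rightarrow> real"
  assumes "g C1_differentiable_on UNIV" "\<And>x. deriv g x \<le> 0"
  shows "antimono g"
proof (rule antimonoI)
  fix x y :: real
  assume "x \<le> y"
  have "(g has_real_derivative deriv g t) (at t)" for t
    using assms(1) by (simp add: C1_differentiable_on_eq DERIV_deriv_iff_real_differentiable)
  then show "g y \<le> g x"
    using DERIV_nonpos_imp_nonincreasing[OF \<open>x \<le> y\<close>] assms(2) by blast
qed

section \<open>Induction over the time levels\<close>

theorem corollary3p2:
  fixes \<alpha> \<tau> h :: real
    and f fp fm :: "real \<Rightarrow> real"
    and U :: "nat \<Rightarrow> int \<Rightarrow> real"
  assumes "0 < \<alpha>" and "\<alpha> < 1"
    and "\<tau> > 0" and "h > 0"
    and "\<And>x. f x = fp x + fm x"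
    and "fp C1_differentiable_on UNIV" and "fm C1_differentiable_on UNIV"
    and "\<And>x. deriv fp x \<ge> 0" and "\<And>x. deriv fm x \<le> 0"
    and "implicit_upwind_solution \<alpha> \<tau> h fp fm U"
    and "\<And>n. finite_TV (U n)"
  shows "\<forall>n\<ge>1. TV (U n) \<le> TV (U 0)"
proof -
  \<comment> \<open>Multiplying the scheme by
    \<open>Gamma (2 - \<alpha>) * \<tau> powr \<alpha>\<close> gives \<open>U (n + 1) j\<close>
    coefficient 1 and the fluxes the factor \<open>\<mu>\<close>. Only its sign matters for their
    monotonicity, so no step restriction arises.\<close>
  define \<mu> where "\<mu> = Gamma (2 - \<alpha>) * \<tau> powr \<alpha> / h"
  have \<mu>: "0 < \<mu>"
    using assms(1-4) by (simp add: \<mu>_def)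
  let ?w = "\<lambda>n j. \<Sum>k = 0..n. caputo_weight \<alpha> n k * U k j"
  have c: "0 \<le> caputo_weight \<alpha> n k" if "k \<in> {0..n}" for n k
    using caputo_weight_nonneg[OF assms(1,2)] that by simp
  have cont: "continuous_on UNIV fp" "continuous_on UNIV fm"
    using assms(6,7) by (auto intro: C1_differentiable_imp_continuous_on)
  have flux: "mono (\<lambda>x. \<mu> * fp x)" "antimono (\<lambda>x. \<mu> * fm x)"
    using C1_deriv_nonneg_imp_mono[OF assms(6,8)] C1_deriv_nonpos_imp_antimono[OF assms(7,9)] \<mu>
    by (auto simp: monotone_def)
  have step: "TV (U (n + 1)) \<le> TV (?w n)" for n
  proof (rule monotone_implicit_step_TV_le[where p = "\<lambda>x. \<mu> * fp x" and q = "\<lambda>x. \<mu> * fm x"])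
    fix j
    define G where "G = Gamma (2 - \<alpha>) * \<tau> powr \<alpha>"
    have "0 < G"
      using assms(1-3) by (simp add: G_def)
    have "1 / G * (U (n + 1) j - ?w n j)
        + 1 / h * (fp (U (n + 1) j) - fp (U (n + 1) (j - 1)))
        + 1 / h * (fm (U (n + 1) (j + 1)) - fm (U (n + 1) j)) = 0" (is "?e = 0")
      using assms(10) by (simp add: implicit_upwind_solution_def discrete_caputo_def G_def)
    then have "G * ?e = 0"
      by simp
    then show "U (n + 1) j - ?w n j
        + (\<mu> * fp (U (n + 1) j) - \<mu> * fp (U (n + 1) (j - 1)))
        + (\<mu> * fm (U (n + 1) (j + 1)) - \<mu> * fm (U (n + 1) j)) = 0"
      using \<open>0 < G\<close> by (simp add: \<mu>_def G_def[symmetric] distrib_left right_diff_distrib)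
  next
    show "finite_TV (?w n)"
      by (rule finite_TV_nonneg_combination) (use c assms(11) in auto)
  qed (use flux cont assms(11) in \<open>auto intro: continuous_on_mult_left\<close>)
  have "TV (U n) \<le> TV (U 0)" for n
  \<comment> \<open>Strong induction, because the history at level \<open>m + 1\<close> involves all
    levels from 0 to \<open>m\<close>.\<close>
  proof (induction n rule: less_induct)
    case (less n)
    show ?case
    proof (cases n)
      case (Suc m)
      have "TV (U n) \<le> TV (?w m)"
        using step[of m] Suc by simp
      also have "\<dots> \<le> (\<Sum>k = 0..m. caputo_weight \<alpha> m k * TV (U k))"
        by (rule TV_nonneg_combination_le) (use c assms(11) in auto)
      also have "\<dots> \<le> (\<Sum>k = 0..m. caputo_weight \<alpha> m k * TV (U 0))"
        by (intro sum_mono mult_left_mono c less.IH) (use Suc in auto)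
      also have "\<dots> = TV (U 0)"
        by (simp add: sum_distrib_right[symmetric] sum_caputo_weight)
      finally show ?thesis .
    qed simp
  qed
  then show ?thesis
    by blast
qed

end
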